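(* Let $(\Sigma^{\infty,+}_{(L)},\sigma_\infty)$ be an NSFT given by alphabets $(\mathcal{A}_i)_{i\ge0}$ and matrices $(L_i)_{i\ge0}$ satisfying (A1) and (A2) of the context. Let $\mu_\infty$ be an IMS for $\sigma_\infty$ and let $m_k(\varepsilon)$ be as defined in the context. Then, for any $\varepsilon>0$, the sequence $\mathcal{P}_{\infty,\varepsilon}=(\mathcal{P}_{k,\varepsilon})_{k=0}^\infty$, $\mathcal{P}_{k,\varepsilon}:=\mathcal{P}_k^{k+m_k(\varepsilon)}$, is admissible, i.e. belongs to $\mathcal{E}_{\mathrm M}(\mu_\infty)$, and $\operatorname{diam}\mathcal{P}_{\infty,\varepsilon}<\varepsilon$. Hence, every IMS for $\sigma_\infty$ is a fine-scale IMS.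
   Context: Let $\mathcal{A}_i=\{1,\dots,l_i\}$, $i\ge0$, be finite alphabets and $L_i$ a $0$-$1$-matrix of dimension $l_i\times l_{i+1}$. Standing assumptions: (A1) no row or column of any $L_i$ is identically zero; (A2) $(l_i)$ is bounded. For $n\le m$ let $w(n,m)$ be the number of words $(x_n,\dots,x_m)$ with $x_i\in\mathcal{A}_i$ for $n\le i\le m$ and $(L_i)_{x_ix_{i+1}}=1$ for $n\le i\le m-1$. For $\varepsilon>0$, $k\ge0$: $m_k(\varepsilon):=\min\{m\ge0:w(k,k+m)>1/\varepsilon\}$. $\Sigma^{k,+}_{(L)}:=\{(x_k,x_{k+1},\dots):x_i\in\mathcal{A}_i,\ (L_i)_{x_ix_{i+1}}=1\ \forall i\ge k\}$, with metric $d_k(x,y)=0$ if $x=y$, $1$ if $x_k\ne y_k$, and $w(k,l)^{-1}$ if $x\ne y$, $x_k=y_k$, $l=\max\{r\ge k:x_i=y_i,\ i=k,\dots,r\}$. $\sigma_k:\Sigma^{k,+}_{(L)}\to\Sigma^{k+1,+}_{(L)}$ is the left shift; the pair $(\Sigma^{\infty,+}_{(L)},\sigma_\infty)$, where $\Sigma^{\infty,+}_{(L)}=(\Sigma^{k,+}_{(L)})_{k\ge0}$ and $\sigma_\infty=(\sigma_k)_{k\ge0}$, is called a nonstationary subshift of finite type (NSFT). The spaces are compact and $\sigma_\infty$ is equicontinuous. Cylinder sets: $[.x_k\dots x_m]:=\{y\in\Sigma^{k,+}_{(L)}:y_i=x_i,\ i=k,\dots,m\}$; cylinder partitions: $\mathcal{P}_k^m:=\{[.x_k\dots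 x_m]:x_i\in\mathcal{A}_i,\ (L_i)_{x_ix_{i+1}}=1,\ k\le i\le m-1\}$ for $0\le k\le m$. An IMS (invariant measure sequence) for $\sigma_\infty$ is a sequence $\mu_\infty=(\mu_k)_{k\ge0}$ of Borel probability measures on the spaces $\Sigma^{k,+}_{(L)}$ with $\sigma_k\mu_k=\mu_{k+1}$ (push-forward) for all $k$. A sequence $\mathcal{P}_\infty=(\mathcal{P}_k)_{k\ge0}$ of finite Borel partitions $\mathcal{P}_k=\{P_{k,1},\dots,P_{k,r_k}\}$ of $\Sigma^{k,+}_{(L)}$ is admissible, $\mathcal{P}_\infty\in\mathcal{E}_{\mathrm M}(\mu_\infty)$, iff $(r_k)$ is bounded and for each $\eta>0$ there are $\delta>0$ and compact (possibly empty) $K_{k,i}\subset P_{k,i}$ such that for all $k\ge0$: $\mu_k(P_{k,i}\setminus K_{k,i})\le\eta$ for all $i$, and $d_k(x,y)\ge\delta$ for all $x\in K_{k,i}$, $y\in K_{k,j}$, $i\ne j$. $\operatorname{diam}\mathcal{P}_\infty:=\sup_{k\ge0}\sup_{P\in\mathcal{P}_k}\operatorname{diam}P$, where $\operatorname{diam}P=\sup_{x,y\in P}d_k(x,y)$ for $P\in\mathcal{P}_k$. An IMS $\mu_\infty$ is a fine-scale IMS if there is a sequence $(\mathcal{P}^j_\infty)_{j\ge0}$ in $\mathcal{E}_{\mathrm M}(\mu_\infty)$ with $\operatorname{diam}\mathcal{P}^j_\infty\to0$ as $j\to\infty$. *)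

theory Defs
  imports "HOL-Probability.Probability_Measure" "HOL-Analysis.Abstract_Metric_Spaces"
    "HOL-Library.Extended_Nat" "HOL-Library.Disjoint_Sets"
begin

definition metric_borel :: "'a set \<Rightarrow> ('a \<Rightarrow> 'a \<Rightarrow> real) \<Rightarrow> 'a measure" where
  "metric_borel X d = sigma X {U. openin (Metric_space.mtopology X d) U}"

definition IMS ::
  "(nat \<Rightarrow> 'a set) \<Rightarrow> (nat \<Rightarrow> 'a \<Rightarrow> 'a \<Rightarrow> real) \<Rightarrow> (nat \<Rightarrow> 'a \<Rightarrow> 'a) \<Rightarrow> (nat \<Rightarrow> 'a measure) \<Rightarrow> bool" where
  "IMS X d f \<mu> \<longleftrightarrow>
     (\<forall>k. prob_space (\<mu> k) \<and> sets (\<mu> k) = sets (metric_borel (X k) (d k))) \<and>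
     (\<forall>k. distr (\<mu> k) (metric_borel (X (Suc k)) (d (Suc k))) (f k) = \<mu> (Suc k))"

text \<open>
  A partition \<open>{P_{k,1}, ..., P_{k,r_k}}\<close> is the set of its members, so \<open>r_k\<close> is its cardinality
  and \<open>K k P\<close> is the compact set inside the member \<open>P\<close>. The \<open>K k P\<close> may be empty.
\<close>

definition admissible ::
  "(nat \<Rightarrow> 'a set) \<Rightarrow> (nat \<Rightarrow> 'a \<Rightarrow> 'a \<Rightarrow> real) \<Rightarrow> (nat \<Rightarrow> 'a measure) \<Rightarrow> (nat \<Rightarrow> 'a set set) set" where
  "admissible X d \<mu> = {\<P>.
     (\<forall>k. finite (\<P> k) \<and> partition_on (X k) (\<P> k) \<and> \<P> k \<subseteq> sets (metric_borel (X k) (d k))) \<and>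
     (\<exists>R. \<forall>k. card (\<P> k) \<le> R) \<and>
     (\<forall>\<eta>>0. \<exists>\<delta>>0. \<exists>K :: nat \<Rightarrow> 'a set \<Rightarrow> 'a set. \<forall>k.
        (\<forall>P\<in>\<P> k. compactin (Metric_space.mtopology (X k) (d k)) (K k P) \<and> K k P \<subseteq> P \<and>
                   measure (\<mu> k) (P - K k P) \<le> \<eta>) \<and>
        (\<forall>P\<in>\<P> k. \<forall>Q\<in>\<P> k. P \<noteq> Q \<longrightarrow> (\<forall>x\<in>K k P. \<forall>y\<in>K k Q. \<delta> \<le> d k x y)))}"

text \<open>Suprema are taken in \<open>[0, \<infinity>]\<close>, where they are always meaningful.\<close>

definition set_diam :: "('a \<Rightarrow> 'a \<Rightarrow> real) \<Rightarrow> 'a set \<Rightarrow> ennreal" where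
  "set_diam d P = (SUP x\<in>P. SUP y\<in>P. ennreal (d x y))"

definition partition_diam :: "(nat \<Rightarrow> 'a \<Rightarrow> 'a \<Rightarrow> real) \<Rightarrow> (nat \<Rightarrow> 'a set set) \<Rightarrow> ennreal" where
  "partition_diam d \<P> = (SUP k. SUP P\<in>\<P> k. set_diam (d k) P)"

definition fine_scale_IMS ::
  "(nat \<Rightarrow> 'a set) \<Rightarrow> (nat \<Rightarrow> 'a \<Rightarrow> 'a \<Rightarrow> real) \<Rightarrow> (nat \<Rightarrow> 'a \<Rightarrow> 'a) \<Rightarrow> (nat \<Rightarrow> 'a measure) \<Rightarrow> bool" where
  "fine_scale_IMS X d f \<mu> \<longleftrightarrow> IMS X d f \<mu> \<and>
     (\<exists>\<P> :: nat \<Rightarrow> nat \<Rightarrow> 'a set set.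
        (\<forall>j. \<P> j \<in> admissible X d \<mu>) \<and> (\<lambda>j. partition_diam d (\<P> j)) \<longlonglongrightarrow> 0)"


text \<open>
  The entry of \<open>L_i\<close> at position \<open>(a, b)\<close> is \<open>L i a b\<close>;
  only \<open>a \<in> {1..l i}\<close> and \<open>b \<in> {1..l (Suc i)}\<close> matter.
\<close>

definition alphabet :: "(nat \<Rightarrow> nat) \<Rightarrow> nat \<Rightarrow> nat set" where
  "alphabet l i = {1..l i}"

definition nsft_data :: "(nat \<Rightarrow> nat) \<Rightarrow> (nat \<Rightarrow> nat \<Rightarrow> nat \<Rightarrow> nat) \<Rightarrow> bool" where
  "nsft_data l L \<longleftrightarrow>
     (\<forall>i. 1 \<le> l i) \<and> (\<forall>i. \<forall>a\<in>alphabet l i. \<forall>b\<in>alphabet l (Suc i). L i a b \<in> {0, 1})"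

definition nsft_A1 :: "(nat \<Rightarrow> nat) \<Rightarrow> (nat \<Rightarrow> nat \<Rightarrow> nat \<Rightarrow> nat) \<Rightarrow> bool" where
  "nsft_A1 l L \<longleftrightarrow>
     (\<forall>i. (\<forall>a\<in>alphabet l i. \<exists>b\<in>alphabet l (Suc i). L i a b \<noteq> 0) \<and>
          (\<forall>b\<in>alphabet l (Suc i). \<exists>a\<in>alphabet l i. L i a b \<noteq> 0))"

definition nsft_A2 :: "(nat \<Rightarrow> nat) \<Rightarrow> bool" where
  "nsft_A2 l \<longleftrightarrow> (\<exists>B. \<forall>i. l i \<le> B)"

text \<open>
  Words \<open>(x_k, ..., x_N)\<close>, as extensional functions on the index range. The end \<open>N\<close> may be
  \<open>\<infinity>\<close>, which gives the one-sided infinite sequences \<open>(x_k, x_{k+1}, ...)\<close>.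
\<close>

definition words ::
  "(nat \<Rightarrow> nat) \<Rightarrow> (nat \<Rightarrow> nat \<Rightarrow> nat \<Rightarrow> nat) \<Rightarrow> nat \<Rightarrow> enat \<Rightarrow> (nat \<Rightarrow> nat) set" where
  "words l L k N = {x \<in> (\<Pi>\<^sub>E i\<in>{i. k \<le> i \<and> enat i \<le> N}. alphabet l i).
     \<forall>i\<ge>k. enat (Suc i) \<le> N \<longrightarrow> L i (x i) (x (Suc i)) = 1}"

definition word_count :: "(nat \<Rightarrow> nat) \<Rightarrow> (nat \<Rightarrow> nat \<Rightarrow> nat \<Rightarrow> nat) \<Rightarrow> nat \<Rightarrow> nat \<Rightarrow> nat" where
  "word_count l L n m = card (words l L n (enat m))"

definition nsft_space :: "(nat \<Rightarrow> nat) \<Rightarrow> (nat \<Rightarrow> nat \<Rightarrow> nat \<Rightarrow> nat) \<Rightarrow> nat \<Rightarrow> (nat \<Rightarrow> nat) set" where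
  "nsft_space l L k = {x \<in> (\<Pi>\<^sub>E i\<in>{k..}. alphabet l i). \<forall>i\<ge>k. L i (x i) (x (Suc i)) = 1}"

definition nsft_dist ::
  "(nat \<Rightarrow> nat) \<Rightarrow> (nat \<Rightarrow> nat \<Rightarrow> nat \<Rightarrow> nat) \<Rightarrow> nat \<Rightarrow> (nat \<Rightarrow> nat) \<Rightarrow> (nat \<Rightarrow> nat) \<Rightarrow> real" where
  "nsft_dist l L k x y =
     (if x = y then 0
      else if x k \<noteq> y k then 1
      else inverse (real (word_count l L k (Max {r. k \<le> r \<and> (\<forall>i\<in>{k..r}. x i = y i)}))))"

definition nsft_shift :: "nat \<Rightarrow> (nat \<Rightarrow> nat) \<Rightarrow> nat \<Rightarrow> nat" where
  "nsft_shift k x = restrict x {Suc k..}"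

definition cylinder ::
  "(nat \<Rightarrow> nat) \<Rightarrow> (nat \<Rightarrow> nat \<Rightarrow> nat \<Rightarrow> nat) \<Rightarrow> nat \<Rightarrow> enat \<Rightarrow> (nat \<Rightarrow> nat) \<Rightarrow> (nat \<Rightarrow> nat) set" where
  "cylinder l L k N x = {y \<in> nsft_space l L k. \<forall>i. k \<le> i \<and> enat i \<le> N \<longrightarrow> y i = x i}"

definition cylinder_partition ::
  "(nat \<Rightarrow> nat) \<Rightarrow> (nat \<Rightarrow> nat \<Rightarrow> nat \<Rightarrow> nat) \<Rightarrow> nat \<Rightarrow> enat \<Rightarrow> (nat \<Rightarrow> nat) set set" where
  "cylinder_partition l L k N = cylinder l L k N ` words l L k N"

text \<open>
  \<open>m_k(\<epsilon>)\<close>. If \<open>w(k, k + m)\<close> never exceeds \<open>1/\<epsilon>\<close> (possible, e.g. for \<open>l i = 1\<close>), the minimum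
  is over the empty set and is read as \<open>\<infinity>\<close>; the cylinder partition is then the partition into
  points.
\<close>

definition cyl_length ::
  "(nat \<Rightarrow> nat) \<Rightarrow> (nat \<Rightarrow> nat \<Rightarrow> nat \<Rightarrow> nat) \<Rightarrow> nat \<Rightarrow> real \<Rightarrow> enat" where
  "cyl_length l L k \<epsilon> = Inf {enat m | m. real (word_count l L k (k + m)) > 1 / \<epsilon>}"

lemma cyl_length_finite:
  assumes "\<exists>m. real (word_count l L k (k + m)) > 1 / \<epsilon>"
  shows "cyl_length l L k \<epsilon> = enat (LEAST m. real (word_count l L k (k + m)) > 1 / \<epsilon>)"
proof -
  let ?Q = "\<lambda>m. real (word_count l L k (k + m)) > 1 / \<epsilon>"
  have "?Q (LEAST m. ?Q m)" using assms by (rule LeastI_ex)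
  moreover have "(LEAST m. ?Q m) \<le> m" if "?Q m" for m using that by (rule Least_le)
  ultimately show ?thesis
    unfolding cyl_length_def by (intro antisym Inf_lower Inf_greatest) auto
qed

lemma cyl_length_infinite:
  assumes "\<And>m. real (word_count l L k (k + m)) \<le> 1 / \<epsilon>"
  shows "cyl_length l L k \<epsilon> = \<infinity>"
proof -
  have "{enat m | m. real (word_count l L k (k + m)) > 1 / \<epsilon>} = {}"
    using assms by (auto simp: not_less)
  then show ?thesis
    unfolding cyl_length_def by (simp add: Inf_enat_def)
qed

lemma nsft_space_eq_words: "nsft_space l L k = words l L k \<infinity>"
  by (simp add: nsft_space_def words_def atLeast_def)

lemma cylinder_partition_infinity:
  "cylinder_partition l L k \<infinity> = (\<lambda>x. {x}) ` nsft_space l L k"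
proof -
  have "cylinder l L k \<infinity> x = {x}" if "x \<in> nsft_space l L k" for x
  proof -
    have "y = x" if "y \<in> cylinder l L k \<infinity> x" for y
      by (rule PiE_ext[of _ "{k..}" "alphabet l"])
        (use that \<open>x \<in> nsft_space l L k\<close> in \<open>auto simp: cylinder_def nsft_space_def\<close>)
    moreover have "x \<in> cylinder l L k \<infinity> x"
      using that by (simp add: cylinder_def)
    ultimately show ?thesis by blast
  qed
  then show ?thesis
    unfolding cylinder_partition_def nsft_space_eq_words[symmetric] by (auto simp: image_iff)
qed

lemma finite_words: "finite (words l L k (enat m))"
proof -
  have "finite {i. k \<le> i \<and> enat i \<le> enat m}"
    by (rule finite_subset[of _ "{..m}"]) auto
  then have "finite (\<Pi>\<^sub>E i\<in>{i. k \<le> i \<and> enat i \<le> enat m}. alphabet l i)"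
    by (intro finite_PiE) (auto simp: alphabet_def)
  then show ?thesis
    by (rule rev_finite_subset) (auto simp: words_def)
qed

lemma word_count_Suc:
  assumes "nsft_data l L" "nsft_A1 l L" "k \<le> m"
  shows "word_count l L k m \<le> word_count l L k (Suc m)"
proof -
  have ex: "\<exists>b. b \<in> alphabet l (Suc m) \<and> L m a b = 1" if "a \<in> alphabet l m" for a
  proof -
    have "\<exists>b\<in>alphabet l (Suc m). L m a b \<noteq> 0"
      using assms(2) that by (simp add: nsft_A1_def)
    then obtain b where b: "b \<in> alphabet l (Suc m)" "L m a b \<noteq> 0" ..
    moreover have "L m a b \<in> {0, 1}"
      using assms(1) that b(1) by (simp add: nsft_data_def)
    ultimately show ?thesis by auto
  qed
  define g where "g a = (SOME b. b \<in> alphabet l (Suc m) \<and> L m a b = 1)" for a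
  have g: "g a \<in> alphabet l (Suc m)" "L m a (g a) = 1" if "a \<in> alphabet l m" for a
    using someI_ex[OF ex[OF that]] unfolding g_def by auto
  define h where "h x = x(Suc m := g (x m))" for x :: "nat \<Rightarrow> nat"
  have ext: "x (Suc m) = undefined" if "x \<in> words l L k (enat m)" for x
    using that unfolding words_def by (auto simp: PiE_def extensional_def)
  have "inj_on h (words l L k (enat m))"
  proof (rule inj_onI)
    fix x y assume *: "x \<in> words l L k (enat m)" "y \<in> words l L k (enat m)" "h x = h y"
    show "x = y"
    proof
      fix i show "x i = y i"
        using fun_cong[OF *(3), of i] ext[OF *(1)] ext[OF *(2)]
        by (cases "i = Suc m") (auto simp: h_def)
    qed
  qed
  moreover have "h ` words l L k (enat m) \<subseteq> words l L k (enat (Suc m))"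
  proof
    fix z assume "z \<in> h ` words l L k (enat m)"
    then obtain x where x: "x \<in> words l L k (enat m)" and z: "z = h x" by auto
    from x have xA: "x i \<in> alphabet l i" if "k \<le> i" "i \<le> m" for i
      using that by (auto simp: words_def PiE_def)
    from x have xL: "L i (x i) (x (Suc i)) = 1" if "k \<le> i" "Suc i \<le> m" for i
      using that by (auto simp: words_def)
    from x have xE: "x i = undefined" if "\<not> (k \<le> i \<and> i \<le> m)" for i
      using that by (auto simp: words_def PiE_def extensional_def)
    have zA: "z i \<in> alphabet l i" if "k \<le> i" "i \<le> Suc m" for i
      using xA g(1) assms(3) that unfolding z h_def by (cases "i = Suc m") auto
    have zL: "L i (z i) (z (Suc i)) = 1" if "k \<le> i" "i \<le> m" for i
      using xA xL g(2) assms(3) that unfolding z h_def by (cases "i = m") auto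
    have zE: "z i = undefined" if "\<not> (k \<le> i \<and> i \<le> Suc m)" for i
      using xE that assms(3) unfolding z h_def by (cases "i = Suc m") auto
    show "z \<in> words l L k (enat (Suc m))"
      unfolding words_def by (intro CollectI conjI PiE_I) (use zA zL zE in auto)
  qed
  ultimately show ?thesis
    unfolding word_count_def by (rule card_inj_on_le[OF _ _ finite_words])
qed

lemma word_count_mono:
  assumes "nsft_data l L" "nsft_A1 l L" "k \<le> m" "m \<le> n"
  shows "word_count l L k m \<le> word_count l L k n"
  using assms(4)
proof (induction rule: dec_induct)
  case (step n)
  then show ?case
    using word_count_Suc[OF assms(1,2), of k n] assms(3) by linarith
qed simp

lemma word_count_pos:
  assumes "x \<in> nsft_space l L k"
  shows "word_count l L k m \<ge> 1"
proof -
  have "restrict x {i. k \<le> i \<and> i \<le> m} \<in> words l L k (enat m)"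
    using assms by (auto simp: words_def nsft_space_def PiE_def Pi_def)
  then have "card (words l L k (enat m)) > 0"
    by (auto simp: card_gt_0_iff finite_words)
  then show ?thesis by (simp add: word_count_def)
qed

lemma nsft_dist_agree:
  assumes "x \<in> nsft_space l L k" "y \<in> nsft_space l L k" "x \<noteq> y" "x k = y k"
  obtains r where "k \<le> r" "\<And>i. k \<le> i \<Longrightarrow> i \<le> r \<Longrightarrow> x i = y i"
    "\<And>s. k \<le> s \<Longrightarrow> (\<And>i. k \<le> i \<Longrightarrow> i \<le> s \<Longrightarrow> x i = y i) \<Longrightarrow> s \<le> r"
    "nsft_dist l L k x y = inverse (real (word_count l L k r))"
proof -
  let ?S = "{r. k \<le> r \<and> (\<forall>i\<in>{k..r}. x i = y i)}"
  obtain j where j: "j \<ge> k" "x j \<noteq> y j"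
    using assms PiE_ext[of x "{k..}" "alphabet l" y] unfolding nsft_space_def by auto
  have "r \<le> j" if "r \<in> ?S" for r
  proof (rule ccontr)
    assume "\<not> r \<le> j"
    then have "j \<in> {k..r}" using j by simp
    then show False using that j by blast
  qed
  then have "?S \<subseteq> {..j}" by blast
  then have fin: "finite ?S" by (rule finite_subset) simp
  have "k \<in> ?S" using assms(4) by auto
  then have M: "Max ?S \<in> ?S" using fin Max_in by blast
  define r where "r = Max ?S"
  have r: "k \<le> r" "\<forall>i\<in>{k..r}. x i = y i"
    using M unfolding r_def[symmetric] by blast+
  show ?thesis
  proof (rule that[OF r(1)])
    show "x i = y i" if "k \<le> i" "i \<le> r" for i
      by (rule bspec[OF r(2)]) (use that in simp)
    show "s \<le> r" if "k \<le> s" "\<And>i. k \<le> i \<Longrightarrow> i \<le> s \<Longrightarrow> x i = y i" for s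
      unfolding r_def by (rule Max_ge[OF fin]) (simp add: that)
    show "nsft_dist l L k x y = inverse (real (word_count l L k r))"
      using assms(3,4) by (simp add: nsft_dist_def r_def)
  qed
qed

lemma nsft_dist_commute: "nsft_dist l L k x y = nsft_dist l L k y x"
  by (simp add: nsft_dist_def eq_commute)

lemma nsft_dist_nonneg: "0 \<le> nsft_dist l L k x y"
  by (simp add: nsft_dist_def)

lemma nsft_dist_le_1:
  assumes "x \<in> nsft_space l L k"
  shows "nsft_dist l L k x y \<le> 1"
  using word_count_pos[OF assms] by (auto simp: nsft_dist_def inverse_le_1_iff)

lemma nsft_dist_ultrametric:
  assumes "nsft_data l L" "nsft_A1 l L"
    and S: "x \<in> nsft_space l L k" "y \<in> nsft_space l L k" "z \<in> nsft_space l L k"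
  shows "nsft_dist l L k x z \<le> max (nsft_dist l L k x y) (nsft_dist l L k y z)"
proof (cases "x = y \<or> y = z \<or> x = z \<or> x k \<noteq> y k \<or> y k \<noteq> z k")
  case True
  moreover have "nsft_dist l L k x z \<le> 1" by (rule nsft_dist_le_1[OF S(1)])
  moreover have "0 \<le> nsft_dist l L k y z" by (rule nsft_dist_nonneg)
  ultimately show ?thesis
    by (auto simp: nsft_dist_def le_max_iff_disj)
next
  case False
  then have ne: "x \<noteq> y" "x k = y k" "y \<noteq> z" "y k = z k" "x \<noteq> z" "x k = z k"
    by simp_all
  obtain r where r: "k \<le> r" "\<And>i. k \<le> i \<Longrightarrow> i \<le> r \<Longrightarrow> x i = y i"
    "\<And>u. k \<le> u \<Longrightarrow> (\<And>i. k \<le> i \<Longrightarrow> i \<le> u \<Longrightarrow> x i = y i) \<Longrightarrow> u \<le> r"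
    "nsft_dist l L k x y = inverse (real (word_count l L k r))"
    by (rule nsft_dist_agree[OF S(1,2) ne(1,2)], rule that) blast+
  obtain s where s: "k \<le> s" "\<And>i. k \<le> i \<Longrightarrow> i \<le> s \<Longrightarrow> y i = z i"
    "\<And>u. k \<le> u \<Longrightarrow> (\<And>i. k \<le> i \<Longrightarrow> i \<le> u \<Longrightarrow> y i = z i) \<Longrightarrow> u \<le> s"
    "nsft_dist l L k y z = inverse (real (word_count l L k s))"
    by (rule nsft_dist_agree[OF S(2,3) ne(3,4)], rule that) blast+
  obtain t where t: "k \<le> t" "\<And>i. k \<le> i \<Longrightarrow> i \<le> t \<Longrightarrow> x i = z i"
    "\<And>u. k \<le> u \<Longrightarrow> (\<And>i. k \<le> i \<Longrightarrow> i \<le> u \<Longrightarrow> x i = z i) \<Longrightarrow> u \<le> t"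
    "nsft_dist l L k x z = inverse (real (word_count l L k t))"
    by (rule nsft_dist_agree[OF S(1,3) ne(5,6)], rule that) blast+
  have "min r s \<le> t"
  proof (rule t(3))
    show "k \<le> min r s" using r(1) s(1) by simp
    show "x i = z i" if "k \<le> i" "i \<le> min r s" for i
      using r(2)[of i] s(2)[of i] that by simp
  qed
  then have "word_count l L k (min r s) \<le> word_count l L k t"
    using r(1) s(1) by (intro word_count_mono[OF assms(1,2)]) simp_all
  moreover have "word_count l L k (min r s) \<ge> 1" by (rule word_count_pos[OF S(1)])
  ultimately have "nsft_dist l L k x z \<le> inverse (real (word_count l L k (min r s)))"
    unfolding t(4) by (intro le_imp_inverse_le) auto
  then show ?thesis
    unfolding r(4) s(4) by (cases "r \<le> s") (auto simp: min_def le_max_iff_disj)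
qed

lemma Metric_space_nsft:
  assumes "nsft_data l L" "nsft_A1 l L"
  shows "Metric_space (nsft_space l L k) (nsft_dist l L k)"
proof
  show "0 \<le> nsft_dist l L k x y" for x y by (rule nsft_dist_nonneg)
  show "nsft_dist l L k x y = nsft_dist l L k y x" for x y by (rule nsft_dist_commute)
  show "nsft_dist l L k x y = 0 \<longleftrightarrow> x = y"
    if "x \<in> nsft_space l L k" "y \<in> nsft_space l L k" for x y
  proof -
    have "word_count l L k m \<noteq> 0" for m
      using word_count_pos[OF that(1), of m] by simp
    then show ?thesis by (simp add: nsft_dist_def)
  qed
  show "nsft_dist l L k x z \<le> nsft_dist l L k x y + nsft_dist l L k y z"
    if "x \<in> nsft_space l L k" "y \<in> nsft_space l L k" "z \<in> nsft_space l L k" for x y z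
    using nsft_dist_ultrametric[OF assms that]
      nsft_dist_nonneg[of l L k x y] nsft_dist_nonneg[of l L k y z] by linarith
qed

end

theory Submission
  imports Defs
begin

text \<open>
  Put \<open>N = k + m_k(\<epsilon>)\<close>. By minimality of \<open>m_k(\<epsilon>)\<close> all \<open>w(k, r)\<close> with \<open>r < N\<close> are at most \<open>1/\<epsilon>\<close>,
  and one more letter multiplies the number of words by at most a bound \<open>B\<close> for the alphabet
  sizes. So \<open>w(k, r) \<le> C = B/\<epsilon> + B\<close> for all \<open>r \<le> N\<close>, uniformly in \<open>k\<close>: there are at most \<open>C\<close>
  cylinders, and points of different cylinders have distance at least \<open>1/C\<close>. As cylinders are
  compact (if \<open>w(k, \<cdot>)\<close> is unbounded, \<open>d_k\<close> is continuous for the product topology; otherwise the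
  space is finite), they serve as their own compact approximations, whatever the measures are. Points of one
  cylinder have distance at most \<open>1/w(k, N)\<close>; since \<open>w(k, N)\<close> is an integer above \<open>1/\<epsilon>\<close>, this is
  at most \<open>1/(\<lfloor>1/\<epsilon>\<rfloor> + 1) < \<epsilon>\<close>, and the strict inequality survives the supremum over \<open>k\<close>.
\<close>

section \<open>Growth of word counts and their uniform bound up to the cylinder length\<close>

lemma restrict_in_words:
  assumes "x \<in> words l L k N" "M \<le> N"
  shows "restrict x {i. k \<le> i \<and> enat i \<le> M} \<in> words l L k M"
proof -
  have "enat i \<le> M" if "enat (Suc i) \<le> M" for i
    using that by (meson enat_ord_simps(1) le_SucI order_refl order_trans)
  moreover have "enat i \<le> N" if "enat i \<le> M" for i
    using that assms(2) by (rule order_trans)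
  ultimately show ?thesis
    using assms(1) by (auto simp: words_def PiE_iff)
qed

lemma word_count_refl_le: "word_count l L k k \<le> l k"
proof -
  have "inj_on (\<lambda>x. x k) (words l L k (enat k))"
  proof (rule inj_onI)
    fix x y assume *: "x \<in> words l L k (enat k)" "y \<in> words l L k (enat k)" "x k = y k"
    then show "x = y"
      by (intro PiE_ext[of x "{i. k \<le> i \<and> enat i \<le> enat k}" "alphabet l" y])
        (auto simp: words_def)
  qed
  moreover have "(\<lambda>x. x k) ` words l L k (enat k) \<subseteq> alphabet l k"
    by (auto simp: words_def PiE_iff)
  ultimately have "card (words l L k (enat k)) \<le> card (alphabet l k)"
    by (rule card_inj_on_le) (simp add: alphabet_def)
  then show ?thesis by (simp add: word_count_def alphabet_def)
qed

text \<open>A word is determined by its prefix up to \<open>m\<close> together with its last letter,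
  so prefix and letter embed the longer words into a product.\<close>

lemma word_count_Suc_le:
  assumes "k \<le> m"
  shows "word_count l L k (Suc m) \<le> word_count l L k m * l (Suc m)"
proof -
  let ?D = "{i. k \<le> i \<and> enat i \<le> enat m}"
  let ?h = "\<lambda>x. (restrict x ?D, x (Suc m))"
  let ?W = "words l L k (enat (Suc m))"
  have "inj_on ?h ?W"
  proof (rule inj_onI)
    fix x y assume *: "x \<in> ?W" "y \<in> ?W" "?h x = ?h y"
    have "x i = y i" if "k \<le> i" "i \<le> Suc m" for i
    proof (cases "i = Suc m")
      case False
      then have "i \<in> ?D" using that by simp
      moreover have "restrict x ?D i = restrict y ?D i" using *(3) by simp
      ultimately show ?thesis by simp
    qed (use *(3) in simp)
    then show "x = y"
      using * by (intro PiE_ext[of x "{i. k \<le> i \<and> enat i \<le> enat (Suc m)}" "alphabet l" y])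
        (auto simp: words_def)
  qed
  moreover have "?h ` ?W \<subseteq> words l L k (enat m) \<times> alphabet l (Suc m)"
  proof
    fix p assume "p \<in> ?h ` ?W"
    then obtain x where x: "x \<in> ?W" "p = ?h x" by auto
    have "x (Suc m) \<in> alphabet l (Suc m)"
      using x(1) assms by (auto simp: words_def PiE_iff)
    then show "p \<in> words l L k (enat m) \<times> alphabet l (Suc m)"
      using x restrict_in_words[OF x(1), of "enat m"] by simp
  qed
  ultimately have "card ?W \<le> card (words l L k (enat m) \<times> alphabet l (Suc m))"
    by (rule card_inj_on_le) (simp add: finite_words alphabet_def)
  then show ?thesis
    by (simp add: word_count_def alphabet_def card_cartesian_product)
qed

lemma word_count_le_inverse:
  assumes "enat m < cyl_length l L k \<epsilon>"
  shows "real (word_count l L k (k + m)) \<le> 1 / \<epsilon>"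
proof (rule ccontr)
  assume "\<not> ?thesis"
  then have "cyl_length l L k \<epsilon> \<le> enat m"
    unfolding cyl_length_def by (intro Inf_lower) auto
  then show False using assms by simp
qed

text \<open>A finite value excludes the empty set under the infimum, so the infimum is a minimum and
  is attained.\<close>

lemma word_count_cyl_length:
  assumes "cyl_length l L k \<epsilon> = enat m"
  shows "real (word_count l L k (k + m)) > 1 / \<epsilon>"
proof -
  have ex: "\<exists>m. real (word_count l L k (k + m)) > 1 / \<epsilon>"
    using assms cyl_length_infinite[of l L k \<epsilon>] by (force simp: not_less)
  show ?thesis
    using LeastI_ex[OF ex] cyl_length_finite[OF ex] assms by simp
qed

text \<open>The summand \<open>real B\<close> covers \<open>r = k\<close>, where there is no shorter
  word to start from. For \<open>r = k + Suc n\<close> the index \<open>n\<close> lies strictly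
  below \<open>cyl_length\<close>, also when that is infinite, and the last letter costs a factor of
  at most \<open>B\<close>.\<close>

lemma word_count_bound:
  assumes "0 < \<epsilon>" "\<And>i. 1 \<le> l i" "\<And>i. l i \<le> B"
    and "k \<le> r" "enat r \<le> enat k + cyl_length l L k \<epsilon>"
  shows "real (word_count l L k r) \<le> real B / \<epsilon> + real B"
proof -
  obtain m where m: "r = k + m" using assms(4) le_Suc_ex by blast
  have B1: "1 \<le> real B" using assms(2,3)[of 0] by linarith
  show ?thesis
  proof (cases m)
    case 0
    have "real (word_count l L k r) \<le> real B"
      using word_count_refl_le[of l L k] assms(3)[of k] m 0 by simp
    also have "\<dots> \<le> real B / \<epsilon> + real B" using assms(1) by simp
    finally show ?thesis .
  next
    case (Suc n)
    have "enat m \<le> cyl_length l L k \<epsilon>"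
      using assms(5) m by (simp flip: plus_enat_simps(1))
    then have "enat n < cyl_length l L k \<epsilon>"
      using Suc by (meson enat_ord_simps(2) lessI less_le_trans)
    then have le: "real (word_count l L k (k + n)) \<le> 1 / \<epsilon>"
      by (rule word_count_le_inverse)
    have "word_count l L k r \<le> word_count l L k (k + n) * l (Suc (k + n))"
      using word_count_Suc_le[of k "k + n" l L] m Suc by simp
    also have "\<dots> \<le> word_count l L k (k + n) * B"
      using assms(3) by (intro mult_left_mono) auto
    finally have "real (word_count l L k r) \<le> real (word_count l L k (k + n)) * real B"
      by (metis of_nat_le_iff of_nat_mult)
    also have "\<dots> \<le> 1 / \<epsilon> * real B"
      using le by (intro mult_right_mono) auto
    finally show ?thesis using B1 by simp
  qed
qed

section \<open>Distance estimates from agreeing and differing coordinates\<close>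

text \<open>The last index of agreement is at least \<open>n\<close>, and word counts do not
  decrease with length because (A1) lets every word be prolonged.\<close>

lemma nsft_dist_le_agree:
  assumes "nsft_data l L" "nsft_A1 l L"
    and S: "x \<in> nsft_space l L k" "y \<in> nsft_space l L k"
    and "k \<le> n" "\<And>i. k \<le> i \<Longrightarrow> i \<le> n \<Longrightarrow> x i = y i"
  shows "nsft_dist l L k x y \<le> inverse (real (word_count l L k n))"
proof (cases "x = y")
  case True
  then show ?thesis by (simp add: nsft_dist_def)
next
  case False
  obtain r where r: "\<And>s. k \<le> s \<Longrightarrow> (\<And>i. k \<le> i \<Longrightarrow> i \<le> s \<Longrightarrow> x i = y i) \<Longrightarrow> s \<le> r"
    "nsft_dist l L k x y = inverse (real (word_count l L k r))"
    using nsft_dist_agree[OF S False] assms(5,6) by (metis order_refl)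
  have "n \<le> r" using r(1)[of n] assms(5,6) by blast
  then have "word_count l L k n \<le> word_count l L k r"
    by (rule word_count_mono[OF assms(1,2,5)])
  moreover have "1 \<le> word_count l L k n" by (rule word_count_pos[OF S(1)])
  ultimately show ?thesis
    unfolding r(2) by (intro le_imp_inverse_le) auto
qed

text \<open>The common prefix ends at some \<open>r < i\<close>, hence within the range where
  \<open>C\<close> bounds the word counts. If already the first letters differ, the distance is 1,
  and \<open>C\<close> is at least \<open>w(k, k)\<close>, hence at least 1.\<close>

lemma nsft_dist_ge_differ:
  assumes S: "x \<in> nsft_space l L k" "y \<in> nsft_space l L k"
    and i: "k \<le> i" "enat i \<le> N" "x i \<noteq> y i"
    and C: "\<And>r. k \<le> r \<Longrightarrow> enat r \<le> N \<Longrightarrow> real (word_count l L k r) \<le> C"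
  shows "inverse C \<le> nsft_dist l L k x y"
proof -
  have pos: "1 \<le> real (word_count l L k r)" for r
    using word_count_pos[OF S(1), of r] by simp
  have "x \<noteq> y" using i(3) by auto
  show ?thesis
  proof (cases "x k = y k")
    case False
    have "enat k \<le> N" using i by (meson enat_ord_simps(1) order_trans)
    then have "1 \<le> C" using C[of k] pos[of k] by simp
    then show ?thesis using False \<open>x \<noteq> y\<close> by (simp add: nsft_dist_def inverse_le_1_iff)
  next
    case True
    obtain r where r: "k \<le> r" "\<And>i. k \<le> i \<Longrightarrow> i \<le> r \<Longrightarrow> x i = y i"
      "nsft_dist l L k x y = inverse (real (word_count l L k r))"
      using nsft_dist_agree[OF S \<open>x \<noteq> y\<close> True] by metis
    have "r < i" using r(2)[of i] i by force
    then have "enat r \<le> N" using i(2) by (meson enat_ord_simps(1) less_imp_le order_trans)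
    then have "real (word_count l L k r) \<le> C" using C r(1) by simp
    then show ?thesis
      unfolding r(3) using pos[of r] by (intro le_imp_inverse_le) auto
  qed
qed

section \<open>Finiteness, extension of words and the cylinder partitions\<close>

text \<open>Finitely many distinct points are already distinct on one common finite window, so they
  embed into the words on that window. Thus every finite subset has at most \<open>c\<close>
  elements, which bounds the whole space.\<close>

lemma finite_nsft_space_bounded:
  assumes "\<And>r. k \<le> r \<Longrightarrow> word_count l L k r \<le> c"
  shows "finite (nsft_space l L k)" "card (nsft_space l L k) \<le> c"
proof -
  have fin: "card F \<le> c" if F: "F \<subseteq> nsft_space l L k" "finite F" for F
  proof -
    have "\<exists>i\<ge>k. x i \<noteq> y i" if "x \<in> F" "y \<in> F" "x \<noteq> y" for x y
      using that F PiE_ext[of x "{k..}" "alphabet l" y] unfolding nsft_space_def by auto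
    then obtain j where j: "\<And>x y. x \<in> F \<Longrightarrow> y \<in> F \<Longrightarrow> x \<noteq> y \<Longrightarrow>
        k \<le> j x y \<and> x (j x y) \<noteq> y (j x y)"
      by metis
    \<comment> \<open>The window must reach a differing index \<open>j x y\<close> for every pair;
      inserting \<open>k\<close> keeps the maximum meaningful for empty \<open>F\<close> and gives
      \<open>k \<le> n\<close>.\<close>
    define n where "n = Max (insert k ((\<lambda>(x, y). j x y) ` (F \<times> F)))"
    have n: "k \<le> n" "\<And>x y. x \<in> F \<Longrightarrow> y \<in> F \<Longrightarrow> j x y \<le> n"
      unfolding n_def using F(2) by (auto intro!: Max_ge)
    let ?D = "{i. k \<le> i \<and> enat i \<le> enat n}"
    have "inj_on (\<lambda>x. restrict x ?D) F"
    proof (rule inj_onI, rule ccontr)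
      fix x y assume *: "x \<in> F" "y \<in> F" "restrict x ?D = restrict y ?D" "x \<noteq> y"
      have "j x y \<in> ?D" using n(2)[of x y] j[of x y] * by simp
      moreover have "restrict x ?D (j x y) = restrict y ?D (j x y)" by (rule fun_cong[OF *(3)])
      ultimately have "x (j x y) = y (j x y)" by simp
      then show False using j[of x y] * by simp
    qed
    moreover have "(\<lambda>x. restrict x ?D) ` F \<subseteq> words l L k (enat n)"
      using F(1) restrict_in_words[of _ l L k \<infinity> "enat n"]
      by (auto simp: nsft_space_eq_words)
    ultimately have "card F \<le> word_count l L k n"
      unfolding word_count_def by (rule card_inj_on_le[OF _ _ finite_words])
    then show ?thesis using assms[OF n(1)] by simp
  qed
  then show "finite (nsft_space l L k)" "card (nsft_space l L k) \<le> c"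
    using finite_if_finite_subsets_card_bdd[of "nsft_space l L k" c] by blast+
qed

lemma nsft_symbol_ex:
  assumes "nsft_data l L" "nsft_A1 l L" "a \<in> alphabet l i"
  shows "\<exists>b. b \<in> alphabet l (Suc i) \<and> L i a b = 1"
  using assms unfolding nsft_data_def nsft_A1_def by (metis empty_iff insert_iff)

text \<open>By the row condition in (A1) every letter has an admissible successor; iterating a
  choice \<open>g\<close> of successors prolongs the finite word to an infinite sequence.\<close>

lemma cylinder_nonempty:
  assumes "nsft_data l L" "nsft_A1 l L" "enat k \<le> N" "x \<in> words l L k N"
  shows "cylinder l L k N x \<noteq> {}"
proof (cases N)
  case infinity
  then show ?thesis
    using assms(4) by (auto simp: cylinder_def nsft_space_eq_words)
next
  case (enat n)
  obtain g where g: "\<And>i a. a \<in> alphabet l i \<Longrightarrow> g i a \<in> alphabet l (Suc i) \<and> L i a (g i a) = 1"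
  proof (rule that)
    show "(SOME b. b \<in> alphabet l (Suc i) \<and> L i a b = 1) \<in> alphabet l (Suc i) \<and>
        L i a (SOME b. b \<in> alphabet l (Suc i) \<and> L i a b = 1) = 1"
      if "a \<in> alphabet l i" for i a
      by (rule someI_ex[OF nsft_symbol_ex[OF assms(1,2) that]])
  qed
  have kn: "k \<le> n" using assms(3) enat by simp
  have x: "\<And>i. k \<le> i \<Longrightarrow> i \<le> n \<Longrightarrow> x i \<in> alphabet l i"
    "\<And>i. k \<le> i \<Longrightarrow> Suc i \<le> n \<Longrightarrow> L i (x i) (x (Suc i)) = 1"
    using assms(4) enat by (auto simp: words_def PiE_iff)
  \<comment> \<open>\<open>s j\<close> is the letter at position \<open>n + j\<close>; since
    \<open>s 0 = x n\<close>, word and tail overlap in one letter.\<close>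
  define s where "s = rec_nat (x n) (\<lambda>j a. g (n + j) a)"
  have s_simps: "s 0 = x n" "\<And>j. s (Suc j) = g (n + j) (s j)" by (simp_all add: s_def)
  have s: "s j \<in> alphabet l (n + j)" for j
    by (induction j) (use x(1)[OF kn] g in \<open>auto simp: s_simps\<close>)
  define z where "z = restrict (\<lambda>i. if i \<le> n then x i else s (i - n)) {k..}"
  have "z i \<in> alphabet l i" if "k \<le> i" for i
    using that x(1)[of i] s[of "i - n"] by (auto simp: z_def)
  moreover have "L i (z i) (z (Suc i)) = 1" if "k \<le> i" for i
  proof -
    \<comment> \<open>Transitions inside the word, across the junction at \<open>n\<close>, and
      inside the tail.\<close>
    consider "Suc i \<le> n" | "i = n" | "n < i" by linarith
    then show ?thesis
    proof cases
      case 1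
      then show ?thesis using that x(2)[of i] by (simp add: z_def)
    next
      case 2
      then show ?thesis using kn g[OF x(1)[OF kn]] s_simps(2)[of 0]
        by (simp add: z_def s_simps(1))
    next
      case 3
      then show ?thesis using that g[OF s[of "i - n"]] s_simps(2)[of "i - n"]
        by (simp add: z_def Suc_diff_le)
    qed
  qed
  ultimately have "z \<in> nsft_space l L k"
    by (auto simp: nsft_space_def z_def PiE_iff)
  then have "z \<in> cylinder l L k N x"
    using enat by (auto simp: cylinder_def z_def)
  then show ?thesis by blast
qed

lemma partition_on_cylinder_partition:
  assumes "nsft_data l L" "nsft_A1 l L" "enat k \<le> N"
  shows "partition_on (nsft_space l L k) (cylinder_partition l L k N)"
proof (rule partition_onI)
  show "\<Union> (cylinder_partition l L k N) = nsft_space l L k"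
  proof (intro equalityI subsetI)
    fix x assume x: "x \<in> nsft_space l L k"
    let ?w = "restrict x {i. k \<le> i \<and> enat i \<le> N}"
    have "?w \<in> words l L k N"
      using x restrict_in_words[of x l L k \<infinity> N] by (simp add: nsft_space_eq_words)
    moreover have "x \<in> cylinder l L k N ?w" using x by (simp add: cylinder_def)
    ultimately show "x \<in> \<Union> (cylinder_partition l L k N)"
      unfolding cylinder_partition_def by blast
  qed (auto simp: cylinder_partition_def cylinder_def)
  show "disjnt P Q"
    if "P \<in> cylinder_partition l L k N" "Q \<in> cylinder_partition l L k N" "P \<noteq> Q" for P Q
  proof (rule ccontr)
    assume "\<not> disjnt P Q"
    then obtain z where "z \<in> P" "z \<in> Q" by (auto simp: disjnt_def)
    then have "P = Q" using that by (auto simp: cylinder_partition_def cylinder_def)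
    then show False using that(3) by simp
  qed
  show "{} \<notin> cylinder_partition l L k N"
    using cylinder_nonempty[OF assms] by (force simp: cylinder_partition_def)
qed

text \<open>Turns lying in different cylinders into the differing coordinate that
  \<open>nsft_dist_ge_differ\<close> asks for.\<close>

lemma cylinder_partition_differ:
  assumes "P \<in> cylinder_partition l L k N" "x \<in> P" "y \<in> nsft_space l L k" "y \<notin> P"
  obtains i where "k \<le> i" "enat i \<le> N" "x i \<noteq> y i"
proof -
  obtain w where w: "P = cylinder l L k N w"
    using assms(1) by (auto simp: cylinder_partition_def)
  obtain i where "k \<le> i" "enat i \<le> N" "y i \<noteq> w i"
    using assms(3,4) by (auto simp: w cylinder_def)
  moreover from this have "x i = w i" using assms(2) by (simp add: w cylinder_def)
  ultimately show ?thesis using that by metis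
qed

text \<open>Cylinders are images of words. For infinite \<open>N\<close> these words are the points
  of the space, and the hypothesis then bounds all word counts, so the space is finite.\<close>

lemma card_cylinder_partition:
  assumes "enat k \<le> N"
    and C: "\<And>r. k \<le> r \<Longrightarrow> enat r \<le> N \<Longrightarrow> word_count l L k r \<le> c"
  shows "finite (cylinder_partition l L k N)" "card (cylinder_partition l L k N) \<le> c"
proof -
  have "finite (words l L k N) \<and> card (words l L k N) \<le> c"
  proof (cases N)
    case infinity
    then show ?thesis
      using finite_nsft_space_bounded[of k l L c] C by (auto simp: nsft_space_eq_words)
  next
    case (enat n)
    then show ?thesis
      using C[of n] assms(1) finite_words by (simp add: word_count_def)
  qed
  then show "finite (cylinder_partition l L k N)" "card (cylinder_partition l L k N) \<le> c"
    unfolding cylinder_partition_def by (auto intro: card_image_le order_trans)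
qed

section \<open>Cylinders are open and compact\<close>

text \<open>Provides Borel measurability of the members. Leaving \<open>P\<close> changes a letter
  at an index up to \<open>N\<close>, so the ball of radius \<open>inverse C\<close> around a point
  of \<open>P\<close> stays inside \<open>P\<close>.\<close>

lemma openin_cylinder_partition:
  assumes "nsft_data l L" "nsft_A1 l L" "enat k \<le> N"
    and C: "\<And>r. k \<le> r \<Longrightarrow> enat r \<le> N \<Longrightarrow> real (word_count l L k r) \<le> C"
    and P: "P \<in> cylinder_partition l L k N"
  shows "openin (Metric_space.mtopology (nsft_space l L k) (nsft_dist l L k)) P"
proof -
  interpret Metric_space "nsft_space l L k" "nsft_dist l L k"
    by (rule Metric_space_nsft[OF assms(1,2)])
  have sub: "P \<subseteq> nsft_space l L k"
    using P by (auto simp: cylinder_partition_def cylinder_def)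
  show ?thesis
    unfolding openin_mtopology
  proof (intro conjI allI impI sub)
    fix x assume x: "x \<in> P"
    then have xs: "x \<in> nsft_space l L k" using sub by blast
    have "0 < C" using C[of k] word_count_pos[OF xs, of k] assms(3) by simp
    moreover have "mball x (inverse C) \<subseteq> P"
    proof (rule ccontr)
      assume "\<not> ?thesis"
      then obtain y where y: "y \<in> nsft_space l L k" "nsft_dist l L k x y < inverse C" "y \<notin> P"
        by (meson in_mball subsetI)
      obtain i where "k \<le> i" "enat i \<le> N" "x i \<noteq> y i"
        by (rule cylinder_partition_differ[OF P x y(1,3)])
      then have "inverse C \<le> nsft_dist l L k x y"
        using C by (rule nsft_dist_ge_differ[OF xs y(1)])
      then show False using y(2) by simp
    qed
    ultimately show "\<exists>r>0. mball x r \<subseteq> P" by (intro exI[of _ "inverse C"]) simp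
  qed
qed

text \<open>Carries compactness from the product topology to the metric one. Unbounded word counts
  make agreement on a long enough finite window force any prescribed closeness, and such agreement
  is an open condition in the product.\<close>

lemma continuous_map_nsft_id:
  assumes "nsft_data l L" "nsft_A1 l L"
    and unb: "\<And>c. \<exists>r\<ge>k. c < word_count l L k r"
  shows "continuous_map
    (subtopology (product_topology (\<lambda>i. discrete_topology (alphabet l i)) {k..}) (nsft_space l L k))
    (Metric_space.mtopology (nsft_space l L k) (nsft_dist l L k)) (\<lambda>x. x)"
proof -
  interpret Metric_space "nsft_space l L k" "nsft_dist l L k"
    by (rule Metric_space_nsft[OF assms(1,2)])
  let ?X = "product_topology (\<lambda>i. discrete_topology (alphabet l i)) {k..}"
  let ?S = "nsft_space l L k"
  have sub: "?S \<subseteq> topspace ?X" by (auto simp: nsft_space_def)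
  have "\<exists>U. openin (subtopology ?X ?S) U \<and> x \<in> U \<and> (\<forall>y\<in>U. y \<in> mball x e)"
    if x: "x \<in> ?S" and e: "0 < e" for x e
  proof -
    obtain n where n: "k \<le> n" "nat \<lceil>inverse e\<rceil> < word_count l L k n" using unb by blast
    have "inverse e < real (word_count l L k n)" using n(2) by linarith
    then have w: "inverse (real (word_count l L k n)) < e"
      using e by (metis inverse_inverse_eq inverse_positive_iff_positive less_imp_inverse_less)
    let ?U = "(\<Inter>i\<in>{k..n}. {y \<in> topspace ?X. y i \<in> {x i}}) \<inter> ?S"
    have "openin ?X (\<Inter>i\<in>{k..n}. {y \<in> topspace ?X. y i \<in> {x i}})"
    proof (rule openin_INT2)
      fix i assume i: "i \<in> {k..n}"
      have "x i \<in> alphabet l i" using x i by (auto simp: nsft_space_def PiE_iff)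
      moreover have "continuous_map ?X (discrete_topology (alphabet l i)) (\<lambda>y. y i)"
        using i by (intro continuous_map_product_projection) auto
      ultimately show "openin ?X {y \<in> topspace ?X. y i \<in> {x i}}"
        by (intro openin_continuous_map_preimage) auto
    qed (use n in auto)
    then have "openin (subtopology ?X ?S) ?U" by (auto simp: openin_subtopology)
    moreover have "x \<in> ?U" using x sub by auto
    moreover have "y \<in> mball x e" if y: "y \<in> ?U" for y
    proof -
      have "nsft_dist l L k x y \<le> inverse (real (word_count l L k n))"
        using x y n(1) by (intro nsft_dist_le_agree[OF assms(1,2)]) auto
      then show ?thesis using w x y by (simp add: in_mball)
    qed
    ultimately show ?thesis by blast
  qed
  then show ?thesis
    unfolding continuous_map_to_metric using sub by auto
qed

text \<open>With bounded word counts the space is finite. Otherwise the cylinder is closed in the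
  product of the finite alphabets, which is compact by Tychonoff, and
  \<open>continuous_map_nsft_id\<close> transports its compactness.\<close>

lemma compactin_cylinder:
  assumes "nsft_data l L" "nsft_A1 l L"
  shows "compactin (Metric_space.mtopology (nsft_space l L k) (nsft_dist l L k)) (cylinder l L k N x)"
proof -
  interpret Metric_space "nsft_space l L k" "nsft_dist l L k"
    by (rule Metric_space_nsft[OF assms])
  let ?S = "nsft_space l L k"
  have sub: "cylinder l L k N x \<subseteq> ?S" by (auto simp: cylinder_def)
  show ?thesis
  proof (cases "\<exists>c. \<forall>r\<ge>k. word_count l L k r \<le> c")
    case True
    then obtain c where "\<And>r. k \<le> r \<Longrightarrow> word_count l L k r \<le> c" by blast
    then have "finite ?S" by (rule finite_nsft_space_bounded)
    then show ?thesis
      using sub by (intro finite_imp_compactin) (auto intro: finite_subset)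
  next
    case False
    let ?X = "product_topology (\<lambda>i. discrete_topology (alphabet l i)) {k..}"
    have proj: "continuous_map ?X (discrete_topology (alphabet l i)) (\<lambda>y. y i)" if "k \<le> i" for i
      using that by (intro continuous_map_product_projection) auto
    have clop: "closedin ?X {y \<in> topspace ?X. y i \<in> A}" if "k \<le> i" "A \<subseteq> alphabet l i" for i A
      using that by (intro closedin_continuous_map_preimage[OF proj]) auto
    have "closedin ?X {y \<in> topspace ?X. L i (y i) (y (Suc i)) = 1}" if "k \<le> i" for i
    proof -
      \<comment> \<open>The condition couples two coordinates; splitting by the letter at
        \<open>i\<close> gives a finite union of intersections of one-coordinate preimages.\<close>
      have "{y \<in> topspace ?X. L i (y i) (y (Suc i)) = 1} =
          (\<Union>a\<in>alphabet l i. {y \<in> topspace ?X. y i \<in> {a}} \<inter>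
             {y \<in> topspace ?X. y (Suc i) \<in> {b \<in> alphabet l (Suc i). L i a b = 1}})"
        using that by (auto simp: PiE_iff)
      moreover have "closedin ?X \<dots>"
      proof (intro closedin_Union)
        show "finite ((\<lambda>a. {y \<in> topspace ?X. y i \<in> {a}} \<inter>
            {y \<in> topspace ?X. y (Suc i) \<in> {b \<in> alphabet l (Suc i). L i a b = 1}}) ` alphabet l i)"
          by (simp add: alphabet_def)
        show "closedin ?X A"
          if A_in: "A \<in> (\<lambda>a. {y \<in> topspace ?X. y i \<in> {a}} \<inter>
            {y \<in> topspace ?X. y (Suc i) \<in> {b \<in> alphabet l (Suc i). L i a b = 1}}) ` alphabet l i" for A
        proof -
          obtain a where "a \<in> alphabet l i" and A: "A = {y \<in> topspace ?X. y i \<in> {a}} \<inter>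
            {y \<in> topspace ?X. y (Suc i) \<in> {b \<in> alphabet l (Suc i). L i a b = 1}}"
            using A_in by blast
          then show ?thesis
            unfolding A using \<open>k \<le> i\<close> by (intro closedin_Int clop) auto
        qed
      qed
      ultimately show ?thesis by simp
    qed
    moreover have "closedin ?X {y \<in> topspace ?X. y i = x i}" if "k \<le> i" for i
    proof -
      \<comment> \<open>Here \<open>x\<close> is arbitrary, so \<open>x i\<close> may lie outside
        the alphabet; the intersection keeps the preimage within the scope of
        \<open>clop\<close>.\<close>
      have "{y \<in> topspace ?X. y i = x i} = {y \<in> topspace ?X. y i \<in> {x i} \<inter> alphabet l i}"
        using that by (auto simp: PiE_iff)
      then show ?thesis using clop[OF that, of "{x i} \<inter> alphabet l i"] by simp
    qed
    moreover have "closedin ?X (topspace ?X)" by (rule closedin_topspace)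
    ultimately have "closedin ?X (\<Inter> (insert (topspace ?X)
        ((\<lambda>i. {y \<in> topspace ?X. L i (y i) (y (Suc i)) = 1}) ` {k..} \<union>
         (\<lambda>i. {y \<in> topspace ?X. y i = x i}) ` {i. k \<le> i \<and> enat i \<le> N})))"
      by (intro closedin_Inter) auto
    also have "\<Inter> (insert (topspace ?X)
        ((\<lambda>i. {y \<in> topspace ?X. L i (y i) (y (Suc i)) = 1}) ` {k..} \<union>
         (\<lambda>i. {y \<in> topspace ?X. y i = x i}) ` {i. k \<le> i \<and> enat i \<le> N})) = cylinder l L k N x"
      by (auto simp: ball_Un cylinder_def nsft_space_def)
    finally have closed: "closedin ?X (cylinder l L k N x)" .
    have "compact_space ?X"
      by (auto simp: compact_space_product_topology compact_space_discrete_topology alphabet_def)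
    then have "compactin ?X (cylinder l L k N x)"
      using closed by (rule closedin_compact_space)
    then have "compactin (subtopology ?X ?S) (cylinder l L k N x)"
      using sub by (simp add: compactin_subtopology)
    moreover have "continuous_map (subtopology ?X ?S) mtopology (\<lambda>y. y)"
      using False by (intro continuous_map_nsft_id[OF assms]) (meson not_le)
    ultimately have "compactin mtopology ((\<lambda>y. y) ` cylinder l L k N x)"
      by (rule image_compactin)
    then show ?thesis by simp
  qed
qed

section \<open>Admissibility, diameter and fine scale\<close>

lemma cylinder_partition_admissible:
  assumes "nsft_data l L" "nsft_A1 l L" "\<And>k. enat k \<le> N k"
    and C: "\<And>k r. k \<le> r \<Longrightarrow> enat r \<le> N k \<Longrightarrow> real (word_count l L k r) \<le> C"
  shows "(\<lambda>k. cylinder_partition l L k (N k)) \<in> admissible (nsft_space l L) (nsft_dist l L) \<mu>"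
proof -
  let ?P = "\<lambda>k. cylinder_partition l L k (N k)"
  let ?d = "nsft_dist l L" and ?X = "nsft_space l L"
  define c where "c = nat \<lfloor>C\<rfloor>"
  have c: "word_count l L k r \<le> c" if "k \<le> r" "enat r \<le> N k" for k r
    using C[OF that] unfolding c_def by (simp add: le_nat_floor)
  have sub: "P \<subseteq> ?X k" if "P \<in> ?P k" for k P
    using that by (auto simp: cylinder_partition_def cylinder_def)
  have meas: "?P k \<subseteq> sets (metric_borel (?X k) (?d k))" for k
  proof -
    interpret Metric_space "?X k" "?d k" by (rule Metric_space_nsft[OF assms(1,2)])
    have "{U. openin mtopology U} \<subseteq> Pow (?X k)"
      using openin_subset[of mtopology] by auto
    then have "{U. openin mtopology U} \<subseteq> sets (metric_borel (?X k) (?d k))"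
      unfolding metric_borel_def by auto
    then show ?thesis
      using openin_cylinder_partition[OF assms(1,2,3) C] by blast
  qed
  \<comment> \<open>The maximum with 1 makes this separation constant positive whatever
    \<open>C\<close> is; it becomes \<open>\<delta>\<close> below, the same for all \<open>k\<close>
    and \<open>\<eta>\<close>.\<close>
  have sep: "inverse (max C 1) \<le> ?d k x y"
    if P: "P \<in> ?P k" "Q \<in> ?P k" "P \<noteq> Q" and x: "x \<in> P" and y: "y \<in> Q" for k P Q x y
  proof -
    have "y \<notin> P"
      using partition_on_cylinder_partition[OF assms(1,2,3)] P y
      by (auto simp: partition_on_def disjoint_def)
    then obtain i where "k \<le> i" "enat i \<le> N k" "x i \<noteq> y i"
      using cylinder_partition_differ[OF P(1) x] sub[OF P(2)] y by blast
    moreover have "real (word_count l L k r) \<le> max C 1" if "k \<le> r" "enat r \<le> N k" for r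
      using C[OF that] by simp
    ultimately show ?thesis
      using sub[OF P(1)] sub[OF P(2)] x y by (intro nsft_dist_ge_differ) auto
  qed
  have comp: "compactin (Metric_space.mtopology (?X k) (?d k)) P" if "P \<in> ?P k" for k P
    using that compactin_cylinder[OF assms(1,2)] by (auto simp: cylinder_partition_def)
  show ?thesis
    unfolding admissible_def
  proof (intro CollectI conjI allI impI)
    show "finite (?P k)" for k
      by (rule card_cylinder_partition[OF assms(3) c])
    show "partition_on (?X k) (?P k)" for k
      by (rule partition_on_cylinder_partition[OF assms(1,2,3)])
    show "?P k \<subseteq> sets (metric_borel (?X k) (?d k))" for k by (rule meas)
    show "\<exists>R. \<forall>k. card (?P k) \<le> R"
      using card_cylinder_partition(2)[OF assms(3) c] by blast
    \<comment> \<open>Taking \<open>K k P = P\<close> leaves the empty set as difference, whose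
      measure is 0.\<close>
    show "\<exists>\<delta>>0. \<exists>K. \<forall>k.
        (\<forall>P\<in>?P k. compactin (Metric_space.mtopology (?X k) (?d k)) (K k P) \<and> K k P \<subseteq> P \<and>
                   measure (\<mu> k) (P - K k P) \<le> \<eta>) \<and>
        (\<forall>P\<in>?P k. \<forall>Q\<in>?P k. P \<noteq> Q \<longrightarrow> (\<forall>x\<in>K k P. \<forall>y\<in>K k Q. \<delta> \<le> ?d k x y))"
      if "0 < \<eta>" for \<eta> :: real
      using that sep comp
      by (intro exI[of _ "inverse (max C 1)"] conjI exI[of _ "\<lambda>_ P. P"]) auto
  qed
qed

lemma partition_diam_le:
  assumes "\<And>k P x y. P \<in> \<P> k \<Longrightarrow> x \<in> P \<Longrightarrow> y \<in> P \<Longrightarrow> d k x y \<le> c"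
  shows "partition_diam d \<P> \<le> ennreal c"
  unfolding partition_diam_def set_diam_def
  by (intro SUP_least ennreal_leI assms)

lemma partition_diam_cylinder_less:
  assumes "nsft_data l L" "nsft_A1 l L" "0 < \<epsilon>"
  shows "partition_diam (nsft_dist l L)
    (\<lambda>k. cylinder_partition l L k (enat k + cyl_length l L k \<epsilon>)) < ennreal \<epsilon>"
proof -
  define c where "c = inverse (real_of_int \<lfloor>1 / \<epsilon>\<rfloor> + 1)"
  have fl: "1 / \<epsilon> < real_of_int \<lfloor>1 / \<epsilon>\<rfloor> + 1" "0 < real_of_int \<lfloor>1 / \<epsilon>\<rfloor> + 1"
    using assms(3) divide_pos_pos[of 1 \<epsilon>] by linarith+
  have "c < \<epsilon>"
    using fl assms(3) unfolding c_def by (simp add: field_simps)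
  have "partition_diam (nsft_dist l L)
      (\<lambda>k. cylinder_partition l L k (enat k + cyl_length l L k \<epsilon>)) \<le> ennreal c"
  proof (rule partition_diam_le)
    fix k P x y
    assume P: "P \<in> cylinder_partition l L k (enat k + cyl_length l L k \<epsilon>)" "x \<in> P" "y \<in> P"
    show "nsft_dist l L k x y \<le> c"
    proof (cases "cyl_length l L k \<epsilon>")
      case infinity
      \<comment> \<open>For infinite length the members are single points.\<close>
      then have "x = y" using P by (auto simp: cylinder_partition_infinity)
      then show ?thesis using fl(2) by (simp add: nsft_dist_def c_def)
    next
      case (enat m)
      have S: "x \<in> nsft_space l L k" "y \<in> nsft_space l L k"
        "\<And>i. k \<le> i \<Longrightarrow> i \<le> k + m \<Longrightarrow> x i = y i"
        using P enat by (auto simp: cylinder_partition_def cylinder_def)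
      have "\<lfloor>1 / \<epsilon>\<rfloor> < int (word_count l L k (k + m))"
        using word_count_cyl_length[OF enat] by (simp add: floor_less_iff)
      then have "real_of_int \<lfloor>1 / \<epsilon>\<rfloor> + 1 \<le> real (word_count l L k (k + m))"
        by linarith
      then have "inverse (real (word_count l L k (k + m))) \<le> c"
        unfolding c_def using fl(2) by (rule le_imp_inverse_le)
      moreover have "nsft_dist l L k x y \<le> inverse (real (word_count l L k (k + m)))"
        by (rule nsft_dist_le_agree[OF assms(1,2) S(1,2)]) (use S(3) in auto)
      ultimately show ?thesis by simp
    qed
  qed
  also have "\<dots> < ennreal \<epsilon>" using \<open>c < \<epsilon>\<close> assms(3) by (simp add: ennreal_lessI)
  finally show ?thesis .
qed

theorem proposition4p7:
  fixes l :: "nat \<Rightarrow> nat" and L :: "nat \<Rightarrow> nat \<Rightarrow> nat \<Rightarrow> nat"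
    and \<mu> :: "nat \<Rightarrow> (nat \<Rightarrow> nat) measure"
  assumes "nsft_data l L" and "nsft_A1 l L" and "nsft_A2 l"
    and "IMS (nsft_space l L) (nsft_dist l L) nsft_shift \<mu>"
  shows "(\<forall>\<epsilon>::real. 0 < \<epsilon> \<longrightarrow>
            (\<lambda>k. cylinder_partition l L k (enat k + cyl_length l L k \<epsilon>))
               \<in> admissible (nsft_space l L) (nsft_dist l L) \<mu> \<and>
            partition_diam (nsft_dist l L)
               (\<lambda>k. cylinder_partition l L k (enat k + cyl_length l L k \<epsilon>)) < ennreal \<epsilon>)
         \<and> fine_scale_IMS (nsft_space l L) (nsft_dist l L) nsft_shift \<mu>"
proof -
  let ?P = "\<lambda>\<epsilon> k. cylinder_partition l L k (enat k + cyl_length l L k \<epsilon>)"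
  obtain B where B: "\<And>i. l i \<le> B" using assms(3) by (auto simp: nsft_A2_def)
  have l1: "\<And>i. 1 \<le> l i" using assms(1) by (simp add: nsft_data_def)
  have adm: "?P \<epsilon> \<in> admissible (nsft_space l L) (nsft_dist l L) \<mu>" if "0 < \<epsilon>" for \<epsilon>
  proof (rule cylinder_partition_admissible[OF assms(1,2)])
    show "enat k \<le> enat k + cyl_length l L k \<epsilon>" for k by simp
    show "real (word_count l L k r) \<le> real B / \<epsilon> + real B"
      if "k \<le> r" "enat r \<le> enat k + cyl_length l L k \<epsilon>" for k r
      using \<open>0 < \<epsilon>\<close> l1 B that by (rule word_count_bound)
  qed
  have diam: "partition_diam (nsft_dist l L) (?P \<epsilon>) < ennreal \<epsilon>" if "0 < \<epsilon>" for \<epsilon>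
    using that by (rule partition_diam_cylinder_less[OF assms(1,2)])
  have "(\<lambda>j. ennreal (inverse (real (Suc j)))) \<longlonglongrightarrow> ennreal 0"
    by (intro tendsto_ennrealI LIMSEQ_inverse_real_of_nat)
  then have lim: "(\<lambda>j. ennreal (inverse (real (Suc j)))) \<longlonglongrightarrow> 0" by simp
  \<comment> \<open>The scales \<open>1 / (j + 1)\<close> are positive for every \<open>j\<close>
    and squeeze the diameters to 0.\<close>
  have "(\<lambda>j. partition_diam (nsft_dist l L) (?P (inverse (real (Suc j))))) \<longlonglongrightarrow> 0"
  proof (rule tendsto_sandwich[OF _ _ tendsto_const lim]; rule always_eventually; rule allI)
    show "0 \<le> partition_diam (nsft_dist l L) (?P (inverse (real (Suc j))))" for j by simp
    show "partition_diam (nsft_dist l L) (?P (inverse (real (Suc j)))) \<le>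
        ennreal (inverse (real (Suc j)))" for j
      by (rule less_imp_le[OF diam]) simp
  qed
  moreover have "\<forall>j. ?P (inverse (real (Suc j))) \<in> admissible (nsft_space l L) (nsft_dist l L) \<mu>"
    by (intro allI adm) simp
  ultimately have "fine_scale_IMS (nsft_space l L) (nsft_dist l L) nsft_shift \<mu>"
    unfolding fine_scale_IMS_def using assms(4)
    by (intro conjI exI[of _ "\<lambda>j. ?P (inverse (real (Suc j)))"])
  then show ?thesis using adm diam by (intro conjI allI impI)
qed

end
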